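(* Let $\epsilon>0$, $\delta\in(0,\tfrac12]$, sensitivities $\Delta_{1,1}A,\Delta_1 b,\Delta_1 c$, and privacy budget allocations $\alpha_A,\alpha_b,\alpha_c>0$ with $\alpha_A+\alpha_b+\alpha_c=1$ be given. Suppose that (Slater) for every $D\in\mathcal D$ there is a point $\bar x$ with $A(D)\bar x<b(D)$ componentwise; (boundedness) $\mathcal D$ is bounded, with publicly known bounds; and (perturbed feasibility) $\bigcap_{D\in\mathcal D}\{x\in\mathbb R^n: A(D)x\le b(D)\}\neq\emptyset$. Then Algorithm 1 (described in the context), viewed as a randomized map $D\mapsto \tilde x^*$, keeps the database $D$ $(\epsilon,\delta)$-differentially private.
   Context: **Setting.** $\mathcal D$ is the set of all possible realizations of a database. For each $D\in\mathcal D$ there are $A(D)\in\mathbb R^{m\times n}$, $b(D)\in\mathbb R^m$, $c(D)\in\mathbb R^n$, defining the linear program (P): maximize $c(D)^Tx$ subject to $A(D)x\le b(D)$, $x\ge 0$. Since $\mathcal D$ is bounded with public bounds, $\sup_{D\in\mathcal D}A(D)_{i,j}$ and $\inf_{D\in\mathcal D}b(D)_i$ are finite, known constants that do not depend on the realized database. **Adjacency and privacy.** $D,D'\in\mathcal D$ are adjacent if they differ in at most one entry. A randomized map $\mathscr M$ on $\mathcal D$ is $(\epsilon,\delta)$-differentially private if $\mathbb P[\mathscr M(D)\in T]\le e^{\epsilon}\,\mathbb P[\mathscr M(D')\in T]+\delta$ for all adjacent $D,D'\in\mathcal D$ and all Borel sets $T$ in its output space. **Sensitivities.** $\Delta_{1,1}A=\sup\sum_{i,j}|A(D)_{i,j}-A(D')_{i,j}|$,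 $\Delta_1 b=\sup\|b(D)-b(D')\|_1$, $\Delta_1c=\sup\|c(D)-c(D')\|_1$, suprema over adjacent $D,D'$; these are taken to be finite and positive. **Noise.** $\mathcal L(\sigma)$ is the zero-mean Laplace distribution with scale $\sigma$. $\mathcal L_T(\sigma,[-s,s])$ is the truncated Laplace distribution on $[-s,s]$ with density proportional to $\exp(-|z|/\sigma)$. All noise draws are mutually independent. **Sensitive entries.** Entry $(i,j)$ of $A$ is sensitive if $A(D)_{i,j}\ne0$ for some $D\in\mathcal D$; let $I_{i,j}=1$ if it is sensitive and $I_{i,j}=0$ otherwise. Entry $j$ of $c$ is sensitive if $c(D)_j\neq 0$ for some $D\in\mathcal D$. **Algorithm 1.** 1. Set $\sigma_A=\frac{\Delta_{1,1}A}{\alpha_A\epsilon}$, $\sigma_b=\frac{\Delta_1b}{\alpha_b\epsilon}$, $\sigma_c=\frac{\Delta_1c}{\alpha_c\epsilon}$. 2. Set $s_A=\frac{\Delta_{1,1}A}{\alpha_A\epsilon}\log\!\left(\frac{2nm(e^{\alpha_A\epsilon}-1)}{\delta}+1\right)$ and $s_b=\frac{\Delta_{1}b}{\alpha_b\epsilon}\log\!\left(\frac{2m(e^{\alpha_b\epsilon}-1)}{\delta}+1\right)$. 3. $\bar A_{i,j}=A(D)_{i,j}+(s_A+Z_{i,j})I_{i,j}$ with $Z_{i,j}\sim\mathcal L_T(\sigma_A,[-s_A,s_A])$. 4. $\bar b_i=b(D)_i-s_b+z_{b,i}$ with $z_{b,i}\sim\mathcal L_T(\sigma_b,[-s_b,s_b])$.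 5. $\tilde A_{i,j}=\min\{\bar A_{i,j},\sup_{D'\in\mathcal D}A(D')_{i,j}\}$ and $\tilde b_i=\max\{\bar b_i,\inf_{D'\in\mathcal D}b(D')_i\}$. 6. $\tilde c_j=c(D)_j+z_{c,j}$ with $z_{c,j}\sim\mathcal L(\sigma_c)$ for each sensitive entry $j$ of $c$, and $\tilde c_j=c(D)_j=0$ for the other entries. 7. Solve, via any algorithm, the private problem (DP-P): maximize $\tilde c^Tx$ subject to $\tilde Ax\le\tilde b$, $x\ge0$, and output its solution $\tilde x^*$. Here the solving algorithm is any (measurable) map of $(\tilde A,\tilde b,\tilde c)$. *)

theory Defs
  imports "HOL-Probability.Probability"
begin

text \<open>
  A database is a vector \<^term>\<open>D :: 'e ^ 'k\<close>: its entries are indexed by the finite type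
  \<^typ>\<open>'k\<close> and take values in \<^typ>\<open>'e\<close>.
\<close>

definition adjacent :: "'e ^ 'k \<Rightarrow> 'e ^ 'k \<Rightarrow> bool" where
  "adjacent D D' \<longleftrightarrow> card {k. D $ k \<noteq> D' $ k} \<le> 1"

text \<open>
  A randomized map is given by the law of its output on each database. The first conjunct
  says that these laws are Borel probability measures; without it a non-measurable
  construction could satisfy the inequality through junk values of \<^const>\<open>measure\<close>.
\<close>

definition differentially_private ::
    "real \<Rightarrow> real \<Rightarrow> ('e ^ 'k) set \<Rightarrow> ('e ^ 'k \<Rightarrow> 'o :: topological_space measure) \<Rightarrow> bool" where
  "differentially_private \<epsilon> \<delta> \<D> \<M> \<longleftrightarrow>
     (\<forall>D\<in>\<D>. prob_space (\<M> D) \<and> sets (\<M> D) = sets borel) \<and>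
     (\<forall>D\<in>\<D>. \<forall>D'\<in>\<D>. adjacent D D' \<longrightarrow>
        (\<forall>T\<in>sets borel. measure (\<M> D) T \<le> exp \<epsilon> * measure (\<M> D') T + \<delta>))"

definition l1_norm :: "real ^ 'n \<Rightarrow> real" where
  "l1_norm x = (\<Sum>j\<in>UNIV. \<bar>x $ j\<bar>)"

definition l11_norm :: "real ^ 'n ^ 'm \<Rightarrow> real" where
  "l11_norm M = (\<Sum>i\<in>UNIV. \<Sum>j\<in>UNIV. \<bar>M $ i $ j\<bar>)"

definition sensitivity_values ::
    "('v \<Rightarrow> real) \<Rightarrow> ('e ^ 'k) set \<Rightarrow> ('e ^ 'k \<Rightarrow> 'v :: minus) \<Rightarrow> real set" where
  "sensitivity_values nrm \<D> f = {nrm (f D - f D') | D D'. D \<in> \<D> \<and> D' \<in> \<D> \<and> adjacent D D'}"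

text \<open>A supremum of reals, hence meaningful only if \<^const>\<open>sensitivity_values\<close> is bounded above.\<close>

definition sensitivity ::
    "('v \<Rightarrow> real) \<Rightarrow> ('e ^ 'k) set \<Rightarrow> ('e ^ 'k \<Rightarrow> 'v :: minus) \<Rightarrow> real" where
  "sensitivity nrm \<D> f = Sup (sensitivity_values nrm \<D> f)"

definition laplace :: "real \<Rightarrow> real measure" where
  "laplace \<sigma> = density lborel (\<lambda>z. ennreal (exp (- \<bar>z\<bar> / \<sigma>) / (2 * \<sigma>)))"

definition trunc_laplace :: "real \<Rightarrow> real \<Rightarrow> real measure" where
  "trunc_laplace \<sigma> s = density lborel
     (\<lambda>z. ennreal (exp (- \<bar>z\<bar> / \<sigma>)) * indicator {-s..s} z
            / (\<integral>\<^sup>+w\<in>{-s..s}. ennreal (exp (- \<bar>w\<bar> / \<sigma>)) \<partial>lborel))"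

definition sensitive_mat :: "'d set \<Rightarrow> ('d \<Rightarrow> real ^ 'n ^ 'm) \<Rightarrow> 'm \<Rightarrow> 'n \<Rightarrow> bool" where
  "sensitive_mat \<D> A i j \<longleftrightarrow> (\<exists>D\<in>\<D>. A D $ i $ j \<noteq> 0)"

definition sensitive_vec :: "'d set \<Rightarrow> ('d \<Rightarrow> real ^ 'n) \<Rightarrow> 'n \<Rightarrow> bool" where
  "sensitive_vec \<D> c j \<longleftrightarrow> (\<exists>D\<in>\<D>. c D $ j \<noteq> 0)"

definition noise_scale :: "real \<Rightarrow> real \<Rightarrow> real \<Rightarrow> real" where
  "noise_scale \<Delta> \<alpha> \<epsilon> = \<Delta> / (\<alpha> * \<epsilon>)"

text \<open>\<open>N\<close> is the number of perturbed entries: \<open>n m\<close> for the matrix and \<open>m\<close> for the right-hand side.\<close>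

definition trunc_radius :: "real \<Rightarrow> real \<Rightarrow> real \<Rightarrow> real \<Rightarrow> nat \<Rightarrow> real" where
  "trunc_radius \<Delta> \<alpha> \<epsilon> \<delta> N =
     \<Delta> / (\<alpha> * \<epsilon>) * ln (2 * real N * (exp (\<alpha> * \<epsilon>) - 1) / \<delta> + 1)"

definition private_A ::
    "'d set \<Rightarrow> ('d \<Rightarrow> real ^ 'n ^ 'm) \<Rightarrow> real \<Rightarrow> 'd \<Rightarrow> ('m \<times> 'n \<Rightarrow> real) \<Rightarrow> real ^ 'n ^ 'm" where
  "private_A \<D> A s D Z =
     (\<chi> i j. min (A D $ i $ j + (s + Z (i, j)) * of_bool (sensitive_mat \<D> A i j))
                 (SUP D'\<in>\<D>. A D' $ i $ j))"

definition private_b ::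
    "'d set \<Rightarrow> ('d \<Rightarrow> real ^ 'm) \<Rightarrow> real \<Rightarrow> 'd \<Rightarrow> ('m \<Rightarrow> real) \<Rightarrow> real ^ 'm" where
  "private_b \<D> b s D z = (\<chi> i. max (b D $ i - s + z i) (INF D'\<in>\<D>. b D' $ i))"

definition private_c ::
    "'d set \<Rightarrow> ('d \<Rightarrow> real ^ 'n) \<Rightarrow> 'd \<Rightarrow> ('n \<Rightarrow> real) \<Rightarrow> real ^ 'n" where
  "private_c \<D> c D z = (\<chi> j. if sensitive_vec \<D> c j then c D $ j + z j else c D $ j)"

text \<open>
  The law of the output on database \<open>D\<close>; independence of all noise draws is encoded by taking
  product measures. The map \<open>solve\<close> receives the data \<open>(A, b, c)\<close> of the private linear program
  (maximize \<open>c\<^sup>T x\<close> subject to \<open>A x \<le> b\<close>, \<open>x \<ge> 0\<close>) and returns a point.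
\<close>

definition algorithm1 ::
    "('e ^ 'k) set \<Rightarrow> ('e ^ 'k \<Rightarrow> real ^ 'n ^ 'm) \<Rightarrow> ('e ^ 'k \<Rightarrow> real ^ 'm) \<Rightarrow> ('e ^ 'k \<Rightarrow> real ^ 'n)
     \<Rightarrow> real \<Rightarrow> real \<Rightarrow> real \<Rightarrow> real \<Rightarrow> real
     \<Rightarrow> ((real ^ 'n ^ 'm) \<times> (real ^ 'm) \<times> (real ^ 'n) \<Rightarrow> real ^ 'n)
     \<Rightarrow> 'e ^ 'k \<Rightarrow> (real ^ 'n) measure" where
  "algorithm1 \<D> A b c \<epsilon> \<delta> \<alpha>\<^sub>A \<alpha>\<^sub>b \<alpha>\<^sub>c solve D =
     (let \<Delta>\<^sub>A = sensitivity l11_norm \<D> A;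
          \<Delta>\<^sub>b = sensitivity l1_norm \<D> b;
          \<Delta>\<^sub>c = sensitivity l1_norm \<D> c;
          \<sigma>\<^sub>A = noise_scale \<Delta>\<^sub>A \<alpha>\<^sub>A \<epsilon>;
          \<sigma>\<^sub>b = noise_scale \<Delta>\<^sub>b \<alpha>\<^sub>b \<epsilon>;
          \<sigma>\<^sub>c = noise_scale \<Delta>\<^sub>c \<alpha>\<^sub>c \<epsilon>;
          s\<^sub>A = trunc_radius \<Delta>\<^sub>A \<alpha>\<^sub>A \<epsilon> \<delta> (CARD('n) * CARD('m));
          s\<^sub>b = trunc_radius \<Delta>\<^sub>b \<alpha>\<^sub>b \<epsilon> \<delta> CARD('m);
          noise = (\<Pi>\<^sub>M ij\<in>(UNIV :: ('m \<times> 'n) set). trunc_laplace \<sigma>\<^sub>A s\<^sub>A)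
                  \<Otimes>\<^sub>M (\<Pi>\<^sub>M i\<in>(UNIV :: 'm set). trunc_laplace \<sigma>\<^sub>b s\<^sub>b)
                  \<Otimes>\<^sub>M (\<Pi>\<^sub>M j\<in>{j. sensitive_vec \<D> c j}. laplace \<sigma>\<^sub>c)
      in distr noise borel (\<lambda>(Z, z\<^sub>b, z\<^sub>c).
           solve (private_A \<D> A s\<^sub>A D Z, private_b \<D> b s\<^sub>b D z\<^sub>b, private_c \<D> c D z\<^sub>c)))"

end

theory Submission imports Defs begin

text \<open>
  The algorithm is private because it sees the database only through the noisy data
  \<open>A(D) + Z\<close>, \<open>b(D) + z\<^sub>b\<close>, \<open>c(D) + z\<^sub>c\<close>. The later steps (the offsets, the clipping against
  suprema and infima over all of \<open>\<D>\<close>, the solver) are one fixed measurable map applied to these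
  data, and no such map can make two laws easier to tell apart
  (\<open>approx_max_div_le_distr\<close>).

  For two adjacent databases the noisy data are families of independent one-dimensional laws that
  differ by translations. Translating Laplace noise of scale \<open>\<sigma>\<close> by \<open>w\<close> costs a factor
  \<open>exp (\<bar>w\<bar> / \<sigma>)\<close>. For noise truncated to \<open>[-s, s]\<close> there is in addition a piece of length \<open>\<bar>w\<bar>\<close> at
  one end of the support where no ratio bound can hold. Its mass
  \<open>(exp (\<bar>w\<bar> / \<sigma>) - 1) / (2 (exp (s / \<sigma>) - 1))\<close> is the additive term
  (\<open>approx_max_div_le_trunc_laplace\<close>), and for the chosen radius it is at most
  \<open>\<delta> / (4 N)\<close> for each of the \<open>N\<close> perturbed entries.

  Both costs add up over independent components (\<open>approx_max_div_le_pair\<close>,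
  \<open>approx_max_div_le_PiM\<close>). The exponents of one block sum to its \<open>l\<^sub>1\<close> distance divided by
  \<open>\<sigma>\<close>, hence to at most its budget \<open>\<alpha> \<epsilon>\<close>, and the three budgets sum to \<open>\<epsilon>\<close>. The additive terms
  of the matrix and of the right-hand side are at most \<open>\<delta> / 2\<close> each, and the
  objective contributes none.
\<close>

section \<open>Approximate max divergence\<close>

text \<open>
  The \<open>\<delta>\<close>-approximate max divergence of \<open>M\<close> from \<open>N\<close> is the infimum of such \<open>\<epsilon>\<close>. The relation is stated
  with \<^const>\<open>emeasure\<close>, so that it can be integrated without integrability side conditions.
\<close>

definition approx_max_div_le :: "real \<Rightarrow> real \<Rightarrow> 'a measure \<Rightarrow> 'a measure \<Rightarrow> bool" where
  "approx_max_div_le \<epsilon> \<delta> M N \<longleftrightarrow>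
     sets M = sets N \<and> (\<forall>T\<in>sets M. emeasure M T \<le> ennreal (exp \<epsilon>) * emeasure N T + ennreal \<delta>)"

lemma approx_max_div_leD:
  assumes "approx_max_div_le \<epsilon> \<delta> M N"
  shows "sets M = sets N"
    and "T \<in> sets M \<Longrightarrow> emeasure M T \<le> ennreal (exp \<epsilon>) * emeasure N T + ennreal \<delta>"
  using assms by (auto simp: approx_max_div_le_def)

lemma approx_max_div_le_mono:
  assumes MN: "approx_max_div_le \<epsilon> \<delta> M N" and "\<epsilon> \<le> \<epsilon>'" "\<delta> \<le> \<delta>'"
  shows "approx_max_div_le \<epsilon>' \<delta>' M N"
  unfolding approx_max_div_le_def
proof (intro conjI ballI)
  fix T assume T: "T \<in> sets M"
  have "emeasure M T \<le> ennreal (exp \<epsilon>) * emeasure N T + ennreal \<delta>"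
    by (rule approx_max_div_leD[OF MN]) fact
  also have "\<dots> \<le> ennreal (exp \<epsilon>') * emeasure N T + ennreal \<delta>'"
    using assms(2,3) by (intro add_mono mult_right_mono ennreal_leI) auto
  finally show "emeasure M T \<le> ennreal (exp \<epsilon>') * emeasure N T + ennreal \<delta>'" .
qed (rule approx_max_div_leD[OF MN])

text \<open>
  Immunity to post-processing: an event of the image is an event of the original law.
\<close>

lemma approx_max_div_le_distr:
  assumes MN: "approx_max_div_le \<epsilon> \<delta> M N" and f: "f \<in> M \<rightarrow>\<^sub>M K"
  shows "approx_max_div_le \<epsilon> \<delta> (distr M K f) (distr N K f)"
proof -
  have sp: "space M = space N" and fN: "f \<in> N \<rightarrow>\<^sub>M K"
    using f approx_max_div_leD(1)[OF MN] by (auto dest: sets_eq_imp_space_eq cong: measurable_cong_sets)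
  show ?thesis
    using f fN approx_max_div_leD(2)[OF MN measurable_sets[OF f]]
    by (auto simp: approx_max_div_le_def emeasure_distr sp)
qed

text \<open>
  The likelihood ratio need only be bounded off a set \<open>B\<close> of small mass: an event splits into its part
  in \<open>B\<close>, paid for by \<open>\<delta>\<close>, and the rest, paid for by the factor \<open>exp \<epsilon>\<close>.
\<close>

lemma approx_max_div_le_density:
  assumes [measurable]: "f \<in> borel_measurable L" "g \<in> borel_measurable L" "B \<in> sets L"
    and le: "\<And>x. x \<in> space L - B \<Longrightarrow> f x \<le> ennreal (exp \<epsilon>) * g x"
    and B: "(\<integral>\<^sup>+x\<in>B. f x \<partial>L) \<le> ennreal \<delta>"
  shows "approx_max_div_le \<epsilon> \<delta> (density L f) (density L g)"
  unfolding approx_max_div_le_def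
proof (intro conjI ballI)
  fix T assume "T \<in> sets (density L f)"
  then have T[measurable]: "T \<in> sets L" by simp
  have "emeasure (density L f) T = (\<integral>\<^sup>+x. f x * indicator T x \<partial>L)"
    by (simp add: emeasure_density)
  also have "\<dots> \<le> (\<integral>\<^sup>+x. ennreal (exp \<epsilon>) * (g x * indicator T x) + f x * indicator B x \<partial>L)"
    using le by (intro nn_integral_mono) (auto simp: indicator_def)
  also have "\<dots> = ennreal (exp \<epsilon>) * (\<integral>\<^sup>+x. g x * indicator T x \<partial>L) + (\<integral>\<^sup>+x. f x * indicator B x \<partial>L)"
    by (simp add: nn_integral_add nn_integral_cmult)
  also have "\<dots> \<le> ennreal (exp \<epsilon>) * emeasure (density L g) T + ennreal \<delta>"
    using B by (simp add: emeasure_density add_mono)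
  finally show "emeasure (density L f) T \<le> ennreal (exp \<epsilon>) * emeasure (density L g) T + ennreal \<delta>" .
qed simp

lemma nn_integral_layer_cake:
  fixes f :: "'a \<Rightarrow> real"
  assumes "sigma_finite_measure M" and [measurable]: "f \<in> borel_measurable M"
    and nonneg: "\<And>x. 0 \<le> f x"
  shows "(\<integral>\<^sup>+x. ennreal (f x) \<partial>M) = (\<integral>\<^sup>+t. emeasure M {x \<in> space M. 0 \<le> t \<and> t < f x} \<partial>lborel)"
proof -
  interpret sigma_finite_measure M by fact
  interpret P: pair_sigma_finite M lborel ..
  have "(\<integral>\<^sup>+x. ennreal (f x) \<partial>M) = (\<integral>\<^sup>+x. (\<integral>\<^sup>+t. indicator {p. 0 \<le> snd p \<and> snd p < f (fst p)} (x, t) \<partial>lborel) \<partial>M)"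
  proof (rule nn_integral_cong)
    fix x
    have "(\<integral>\<^sup>+t. indicator {p. 0 \<le> snd p \<and> snd p < f (fst p)} (x, t) \<partial>lborel) = (\<integral>\<^sup>+t. indicator {0..<f x} t \<partial>lborel)"
      by (intro nn_integral_cong) (auto simp: indicator_def)
    also have "\<dots> = ennreal (f x)" using nonneg[of x] by simp
    finally show "ennreal (f x) = (\<integral>\<^sup>+t. indicator {p. 0 \<le> snd p \<and> snd p < f (fst p)} (x, t) \<partial>lborel)" ..
  qed
  also have "\<dots> = (\<integral>\<^sup>+t. (\<integral>\<^sup>+x. indicator {p. 0 \<le> snd p \<and> snd p < f (fst p)} (x, t) \<partial>M) \<partial>lborel)"
    by (rule P.Fubini'[symmetric]) measurable
  also have "\<dots> = (\<integral>\<^sup>+t. emeasure M {x \<in> space M. 0 \<le> t \<and> t < f x} \<partial>lborel)"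
  proof (rule nn_integral_cong)
    fix t :: real
    have "(\<integral>\<^sup>+x. indicator {p. 0 \<le> snd p \<and> snd p < f (fst p)} (x, t) \<partial>M)
        = (\<integral>\<^sup>+x. indicator {x \<in> space M. 0 \<le> t \<and> t < f x} x \<partial>M)"
      by (intro nn_integral_cong) (auto simp: indicator_def)
    then show "(\<integral>\<^sup>+x. indicator {p. 0 \<le> snd p \<and> snd p < f (fst p)} (x, t) \<partial>M)
        = emeasure M {x \<in> space M. 0 \<le> t \<and> t < f x}" by simp
  qed
  finally show ?thesis .
qed

text \<open>
  The inequality passes from events to functions with values in \<open>[0, 1]\<close> by integrating it over the
  super-level sets \<open>{x. t < f x}\<close>. Only the levels \<open>t \<in> [0, 1)\<close> contribute, so that the additive term
  \<open>\<delta>\<close> is charged once.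
\<close>

lemma approx_max_div_le_nn_integral:
  fixes f :: "'a \<Rightarrow> real"
  assumes MN: "approx_max_div_le \<epsilon> \<delta> M N"
    and M: "sigma_finite_measure M" and N: "sigma_finite_measure N"
    and f[measurable]: "f \<in> borel_measurable M" and f01: "\<And>x. 0 \<le> f x" "\<And>x. f x \<le> 1"
  shows "(\<integral>\<^sup>+x. ennreal (f x) \<partial>M) \<le> ennreal (exp \<epsilon>) * (\<integral>\<^sup>+x. ennreal (f x) \<partial>N) + ennreal \<delta>"
proof -
  interpret N: sigma_finite_measure N by fact
  note sets_eq = approx_max_div_leD(1)[OF MN]
  have sp: "space M = space N" using sets_eq by (rule sets_eq_imp_space_eq)
  have fN[measurable]: "f \<in> borel_measurable N" using f sets_eq by (simp cong: measurable_cong_sets)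
  have mN[measurable]: "(\<lambda>t. emeasure N {x \<in> space N. 0 \<le> t \<and> t < f x}) \<in> borel_measurable lborel"
  proof -
    have "(\<lambda>t. emeasure N (Pair t -` {p \<in> space (lborel \<Otimes>\<^sub>M N). 0 \<le> fst p \<and> fst p < f (snd p)})) \<in> borel_measurable lborel"
      by (rule N.measurable_emeasure_Pair) measurable
    moreover have "Pair t -` {p \<in> space (lborel \<Otimes>\<^sub>M N). 0 \<le> fst p \<and> fst p < f (snd p)} = {x \<in> space N. 0 \<le> t \<and> t < f x}" for t
      by (auto simp: space_pair_measure)
    ultimately show ?thesis by simp
  qed
  have "(\<integral>\<^sup>+x. ennreal (f x) \<partial>M) = (\<integral>\<^sup>+t. emeasure M {x \<in> space M. 0 \<le> t \<and> t < f x} \<partial>lborel)"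
    by (rule nn_integral_layer_cake) (use M f01 in auto)
  also have "\<dots> \<le> (\<integral>\<^sup>+t. ennreal (exp \<epsilon>) * emeasure N {x \<in> space N. 0 \<le> t \<and> t < f x} + ennreal \<delta> * indicator {0..1} t \<partial>lborel)"
  proof (rule nn_integral_mono)
    fix t :: real
    show "emeasure M {x \<in> space M. 0 \<le> t \<and> t < f x}
       \<le> ennreal (exp \<epsilon>) * emeasure N {x \<in> space N. 0 \<le> t \<and> t < f x} + ennreal \<delta> * indicator {0..1} t"
    proof (cases "t \<in> {0..1}")
      case True
      have "{x \<in> space M. 0 \<le> t \<and> t < f x} \<in> sets M" by measurable
      from approx_max_div_leD(2)[OF MN this] show ?thesis using True by (simp add: sp)
    next
      case False
      have "{x \<in> space M. 0 \<le> t \<and> t < f x} = {}"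
        using False order.strict_trans2[OF _ f01(2), of t] by auto
      then show ?thesis by (simp only: emeasure_empty zero_le)
    qed
  qed
  also have "\<dots> = ennreal (exp \<epsilon>) * (\<integral>\<^sup>+t. emeasure N {x \<in> space N. 0 \<le> t \<and> t < f x} \<partial>lborel) + ennreal \<delta>"
    by (simp add: nn_integral_add nn_integral_cmult nn_integral_cmult_indicator)
  also have "(\<integral>\<^sup>+t. emeasure N {x \<in> space N. 0 \<le> t \<and> t < f x} \<partial>lborel) = (\<integral>\<^sup>+x. ennreal (f x) \<partial>N)"
    by (rule nn_integral_layer_cake[symmetric]) (use N f01 in auto)
  finally show ?thesis .
qed

section \<open>Independent composition\<close>

text \<open>
  Additivity under independent composition. The sections of \<open>T\<close> satisfy the inequality for the second
  factor, and what remains is an integral over the first factor. Truncating its integrand at \<open>1\<close>, which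
  is harmless because \<open>M2\<close> is a probability measure, makes the preceding lemma applicable; otherwise
  \<open>\<delta>1\<close> would be multiplied by \<open>exp \<epsilon>2\<close>.
\<close>

lemma approx_max_div_le_pair:
  assumes 1: "approx_max_div_le \<epsilon>1 \<delta>1 M1 N1" and 2: "approx_max_div_le \<epsilon>2 \<delta>2 M2 N2"
    and "prob_space M1" "prob_space N1" "prob_space M2" "prob_space N2"
    and \<delta>: "0 \<le> \<delta>1" "0 \<le> \<delta>2"
  shows "approx_max_div_le (\<epsilon>1 + \<epsilon>2) (\<delta>1 + \<delta>2) (M1 \<Otimes>\<^sub>M M2) (N1 \<Otimes>\<^sub>M N2)"
  unfolding approx_max_div_le_def
proof (intro conjI ballI)
  interpret M1: prob_space M1 by fact
  interpret N1: prob_space N1 by fact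
  interpret M2: prob_space M2 by fact
  interpret N2: prob_space N2 by fact
  note s1 = approx_max_div_leD(1)[OF 1] and s2 = approx_max_div_leD(1)[OF 2]
  show s: "sets (M1 \<Otimes>\<^sub>M M2) = sets (N1 \<Otimes>\<^sub>M N2)" using s1 s2 by (rule sets_pair_measure_cong)
  fix T assume T: "T \<in> sets (M1 \<Otimes>\<^sub>M M2)"
  have T': "T \<in> sets (N1 \<Otimes>\<^sub>M N2)" and T'': "T \<in> sets (M1 \<Otimes>\<^sub>M N2)"
    using T s sets_pair_measure_cong[OF s1 refl, of N2] by auto
  define g where "g x = min 1 (exp \<epsilon>2 * measure N2 (Pair x -` T))" for x
  have g[measurable]: "g \<in> borel_measurable M1"
    unfolding g_def measure_def using N2.measurable_emeasure_Pair[OF T''] by measurable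
  have g01: "0 \<le> g x" "g x \<le> 1" for x by (auto simp: g_def)
  have "emeasure (M1 \<Otimes>\<^sub>M M2) T = (\<integral>\<^sup>+x. emeasure M2 (Pair x -` T) \<partial>M1)"
    by (rule M2.emeasure_pair_measure_alt[OF T])
  also have "\<dots> \<le> (\<integral>\<^sup>+x. ennreal (g x) + ennreal \<delta>2 \<partial>M1)"
  proof (rule nn_integral_mono)
    fix x
    have "emeasure M2 (Pair x -` T) \<le> ennreal (exp \<epsilon>2) * emeasure N2 (Pair x -` T) + ennreal \<delta>2"
      by (rule approx_max_div_leD(2)[OF 2]) (rule sets_Pair1[OF T])
    then have "ennreal (measure M2 (Pair x -` T)) \<le> ennreal (exp \<epsilon>2 * measure N2 (Pair x -` T) + \<delta>2)"
      using \<delta> by (simp add: M2.emeasure_eq_measure N2.emeasure_eq_measure ennreal_mult ennreal_plus)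
    then have "measure M2 (Pair x -` T) \<le> exp \<epsilon>2 * measure N2 (Pair x -` T) + \<delta>2"
      using \<delta> by (subst (asm) ennreal_le_iff) auto
    moreover have "measure M2 (Pair x -` T) \<le> 1 + \<delta>2"
      using \<delta> M2.prob_le_1[of "Pair x -` T"] by linarith
    ultimately have "measure M2 (Pair x -` T) \<le> g x + \<delta>2"
      by (auto simp: g_def min_def)
    then show "emeasure M2 (Pair x -` T) \<le> ennreal (g x) + ennreal \<delta>2"
      using \<delta> g01 by (simp add: M2.emeasure_eq_measure flip: ennreal_plus)
  qed
  also have "\<dots> = (\<integral>\<^sup>+x. ennreal (g x) \<partial>M1) + ennreal \<delta>2"
    by (simp add: nn_integral_add M1.emeasure_space_1)
  also have "\<dots> \<le> (ennreal (exp \<epsilon>1) * (\<integral>\<^sup>+x. ennreal (g x) \<partial>N1) + ennreal \<delta>1) + ennreal \<delta>2"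
    using g01 by (intro add_right_mono approx_max_div_le_nn_integral[OF 1])
      (auto intro: M1.sigma_finite_measure_axioms N1.sigma_finite_measure_axioms)
  also have "\<dots> \<le> (ennreal (exp \<epsilon>1) * (\<integral>\<^sup>+x. ennreal (exp \<epsilon>2) * emeasure N2 (Pair x -` T) \<partial>N1) + ennreal \<delta>1) + ennreal \<delta>2"
    by (intro add_right_mono mult_left_mono nn_integral_mono)
      (auto simp: g_def N2.emeasure_eq_measure ennreal_leI simp flip: ennreal_mult)
  also have "\<dots> = ennreal (exp \<epsilon>1) * (ennreal (exp \<epsilon>2) * (\<integral>\<^sup>+x. emeasure N2 (Pair x -` T) \<partial>N1)) + ennreal \<delta>1 + ennreal \<delta>2"
    using N2.measurable_emeasure_Pair[OF T'] by (simp add: nn_integral_cmult)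
  also have "\<dots> = ennreal (exp (\<epsilon>1 + \<epsilon>2)) * emeasure (N1 \<Otimes>\<^sub>M N2) T + ennreal (\<delta>1 + \<delta>2)"
    using \<delta> N2.emeasure_pair_measure_alt[OF T']
    by (simp add: exp_add ennreal_mult ennreal_plus mult.assoc add.assoc)
  finally show "emeasure (M1 \<Otimes>\<^sub>M M2) T
      \<le> ennreal (exp (\<epsilon>1 + \<epsilon>2)) * emeasure (N1 \<Otimes>\<^sub>M N2) T + ennreal (\<delta>1 + \<delta>2)" .
qed

lemma approx_max_div_le_PiM:
  assumes "finite I"
    and "\<And>i. i \<in> I \<Longrightarrow> approx_max_div_le (e i) (d i) (M i) (N i)"
    and "\<And>i. i \<in> I \<Longrightarrow> prob_space (M i)" "\<And>i. i \<in> I \<Longrightarrow> prob_space (N i)"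
    and "\<And>i. i \<in> I \<Longrightarrow> 0 \<le> d i"
  shows "approx_max_div_le (\<Sum>i\<in>I. e i) (\<Sum>i\<in>I. d i) (PiM I M) (PiM I N)"
  using assms
proof (induction I rule: finite_induct)
  case empty
  then show ?case by (simp add: approx_max_div_le_def PiM_empty)
next
  case (insert k I)
  have s: "sets (PiM (insert k I) M) = sets (PiM (insert k I) N)"
    by (intro sets_PiM_cong) (use insert.prems(1) in \<open>auto dest: approx_max_div_leD\<close>)
  have "approx_max_div_le (e k + (\<Sum>i\<in>I. e i)) (d k + (\<Sum>i\<in>I. d i)) (M k \<Otimes>\<^sub>M PiM I M) (N k \<Otimes>\<^sub>M PiM I N)"
    using insert by (intro approx_max_div_le_pair prob_space_PiM sum_nonneg) auto
  from approx_max_div_le_distr[OF this, of "\<lambda>(x, X). X(k := x)" "PiM (insert k I) M"]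
  have "approx_max_div_le (e k + (\<Sum>i\<in>I. e i)) (d k + (\<Sum>i\<in>I. d i))
     (distr (M k \<Otimes>\<^sub>M PiM I M) (PiM (insert k I) M) (\<lambda>(x, X). X(k := x)))
     (distr (N k \<Otimes>\<^sub>M PiM I N) (PiM (insert k I) M) (\<lambda>(x, X). X(k := x)))"
    by (simp add: measurable_add_dim)
  moreover have "distr (N k \<Otimes>\<^sub>M PiM I N) (PiM (insert k I) M) (\<lambda>(x, X). X(k := x)) =
       distr (N k \<Otimes>\<^sub>M PiM I N) (PiM (insert k I) N) (\<lambda>(x, X). X(k := x))"
    by (rule distr_cong) (use s in auto)
  ultimately show ?case
    using insert by (simp add: distr_pair_PiM_eq_PiM)
qed

lemma distr_PiM_coordinatewise:
  assumes M: "\<And>i. i \<in> I \<Longrightarrow> prob_space (M i)"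
    and f: "\<And>i. i \<in> I \<Longrightarrow> f i \<in> M i \<rightarrow>\<^sub>M K i"
  shows "distr (PiM I M) (PiM I K) (\<lambda>x. \<lambda>i\<in>I. f i (x i)) = PiM I (\<lambda>i. distr (M i) (K i) (f i))"
proof -
  have meas: "(\<lambda>x. \<lambda>i\<in>I. f i (x i)) \<in> PiM I M \<rightarrow>\<^sub>M PiM I K"
    using f by (intro measurable_restrict measurable_compose[OF measurable_component_singleton])
  show ?thesis
  proof (rule measure_eqI_PiM_infinite)
    show "sets (PiM I (\<lambda>i. distr (M i) (K i) (f i))) = sets (PiM I K)"
      by (intro sets_PiM_cong) auto
    interpret prob_space "distr (PiM I M) (PiM I K) (\<lambda>x. \<lambda>i\<in>I. f i (x i))"
      by (intro prob_space.prob_space_distr prob_space_PiM M meas)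
    show "finite_measure (distr (PiM I M) (PiM I K) (\<lambda>x. \<lambda>i\<in>I. f i (x i)))"
      by (rule finite_measure_axioms)
    fix A J assume J: "finite J" "J \<subseteq> I" and A: "\<And>i. i \<in> J \<Longrightarrow> A i \<in> sets (K i)"
    have "(\<lambda>x. \<lambda>i\<in>I. f i (x i)) -` prod_emb I K J (Pi\<^sub>E J A) \<inter> space (PiM I M)
        = prod_emb I M J (\<Pi>\<^sub>E i\<in>J. f i -` A i \<inter> space (M i))"
      using J f[THEN measurable_space] by (fastforce simp: prod_emb_def space_PiM PiE_iff)
    then have "distr (PiM I M) (PiM I K) (\<lambda>x. \<lambda>i\<in>I. f i (x i)) (prod_emb I K J (Pi\<^sub>E J A))
        = (\<Prod>i\<in>J. emeasure (M i) (f i -` A i \<inter> space (M i)))"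
      using J A f M by (subst emeasure_distr[OF meas])
        (auto intro!: sets_PiM_I simp: emeasure_PiM_emb measurable_sets subset_iff)
    also have "\<dots> = (\<Prod>i\<in>J. emeasure (distr (M i) (K i) (f i)) (A i))"
      using J A f by (intro prod.cong) (auto simp: emeasure_distr)
    also have "\<dots> = PiM I (\<lambda>i. distr (M i) (K i) (f i)) (prod_emb I (\<lambda>i. distr (M i) (K i) (f i)) J (Pi\<^sub>E J A))"
      using J A f M by (subst emeasure_PiM_emb) (auto intro: prob_space.prob_space_distr)
    also have "prod_emb I (\<lambda>i. distr (M i) (K i) (f i)) J (Pi\<^sub>E J A) = prod_emb I K J (Pi\<^sub>E J A)"
      by (simp add: prod_emb_def)
    finally show "distr (PiM I M) (PiM I K) (\<lambda>x. \<lambda>i\<in>I. f i (x i)) (prod_emb I K J (Pi\<^sub>E J A))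
        = PiM I (\<lambda>i. distr (M i) (K i) (f i)) (prod_emb I K J (Pi\<^sub>E J A))" .
  qed simp
qed

section \<open>Translates of the Laplace and the truncated Laplace law\<close>

text \<open>
  By the triangle inequality, moving the centre of \<open>exp (- \<bar>z\<bar> / \<sigma>)\<close> from \<open>v\<close> to \<open>u\<close> changes it by a
  factor of at most \<open>exp (\<bar>u - v\<bar> / \<sigma>)\<close>. If the support is cut down to \<open>S\<close>, this fails only at the points
  of \<open>u + S\<close> outside \<open>v + S\<close>, and their mass has to be covered by \<open>\<delta>\<close>. With \<open>S = UNIV\<close> this treats the
  Laplace law, with \<open>S = {-s..s}\<close> the truncated one.
\<close>

lemma approx_max_div_le_shift_exp:
  fixes u v \<sigma> :: real
  assumes \<sigma>: "0 < \<sigma>" and S[measurable]: "S \<in> sets borel"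
    and bad: "(\<integral>\<^sup>+z\<in>{z \<in> S. u - v + z \<notin> S}. ennreal (exp (- \<bar>z\<bar> / \<sigma>)) \<partial>lborel) / K \<le> ennreal \<delta>"
  defines "f \<equiv> \<lambda>z. ennreal (exp (- \<bar>z\<bar> / \<sigma>)) * indicator S z / K"
  shows "approx_max_div_le (\<bar>u - v\<bar> / \<sigma>) \<delta>
    (distr (density lborel f) borel ((+) u)) (distr (density lborel f) borel ((+) v))"
proof -
  have [measurable]: "f \<in> borel_measurable borel" unfolding f_def by measurable
  have shift: "distr (density lborel f) borel ((+) a) = density lborel (\<lambda>y. f (y - a))" for a
    using density_distr[of "\<lambda>y. f (y - a)" borel "(+) a" lborel] by (simp add: lborel_distr_plus)
  define B where "B = {y. y - u \<in> S \<and> y - v \<notin> S}"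
  have B[measurable]: "B \<in> sets borel" unfolding B_def by measurable
  have "(\<integral>\<^sup>+y. f (y - u) * indicator B y \<partial>lborel) = (\<integral>\<^sup>+z. f z * indicator B (u + z) \<partial>lborel)"
    by (subst nn_integral_real_affine[where c = 1 and t = u]) auto
  also have "\<dots> = (\<integral>\<^sup>+z. ennreal (exp (- \<bar>z\<bar> / \<sigma>)) * indicator {z \<in> S. u - v + z \<notin> S} z / K \<partial>lborel)"
    by (intro nn_integral_cong) (auto simp: f_def B_def indicator_def algebra_simps)
  also have "\<dots> = (\<integral>\<^sup>+z\<in>{z \<in> S. u - v + z \<notin> S}. ennreal (exp (- \<bar>z\<bar> / \<sigma>)) \<partial>lborel) / K"
    by (intro nn_integral_divide) measurable
  finally have Bmass: "(\<integral>\<^sup>+y. f (y - u) * indicator B y \<partial>lborel) \<le> ennreal \<delta>" using bad by simp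
  have ratio: "f (y - u) \<le> ennreal (exp (\<bar>u - v\<bar> / \<sigma>)) * f (y - v)" if "y \<notin> B" for y
  proof (cases "y - u \<in> S")
    case True
    then have "y - v \<in> S" using that by (simp add: B_def)
    have "- \<bar>y - u\<bar> / \<sigma> \<le> \<bar>u - v\<bar> / \<sigma> + - \<bar>y - v\<bar> / \<sigma>"
      using \<sigma> by (simp add: field_simps)
    then have "exp (- \<bar>y - u\<bar> / \<sigma>) \<le> exp (\<bar>u - v\<bar> / \<sigma>) * exp (- \<bar>y - v\<bar> / \<sigma>)"
      by (simp flip: exp_add)
    then have "ennreal (exp (- \<bar>y - u\<bar> / \<sigma>)) \<le> ennreal (exp (\<bar>u - v\<bar> / \<sigma>)) * ennreal (exp (- \<bar>y - v\<bar> / \<sigma>))"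
      by (simp add: ennreal_leI flip: ennreal_mult)
    from divide_right_mono_ennreal[OF this, of K] show ?thesis
      using True \<open>y - v \<in> S\<close> by (simp add: f_def ennreal_times_divide)
  qed (simp add: f_def)
  show ?thesis unfolding shift
    by (rule approx_max_div_le_density[where B = B]) (use Bmass ratio in auto)
qed

lemma nn_integral_exp_reflect:
  assumes [measurable]: "S \<in> sets borel"
  shows "(\<integral>\<^sup>+z\<in>uminus ` S. ennreal (exp (- \<bar>z\<bar> / \<sigma>)) \<partial>lborel)
       = (\<integral>\<^sup>+z\<in>S. ennreal (exp (- \<bar>z\<bar> / \<sigma>)) \<partial>lborel)"
proof -
  have [simp]: "indicator (uminus ` S) (- z) = indicator S z" for z :: real
    by (auto simp: indicator_def)
  have [measurable]: "uminus ` S \<in> sets borel"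
  proof -
    have "uminus ` S = {x. - x \<in> S}" by force
    also have "\<dots> \<in> sets borel" by measurable
    finally show ?thesis .
  qed
  show ?thesis
    by (subst nn_integral_real_affine[where c = "-1" and t = 0]) auto
qed

lemma nn_integral_exp_Icc:
  assumes "0 < \<sigma>" "0 \<le> a" "a \<le> b"
  shows "(\<integral>\<^sup>+z\<in>{a..b}. ennreal (exp (- \<bar>z\<bar> / \<sigma>)) \<partial>lborel)
       = ennreal (\<sigma> * (exp (- a / \<sigma>) - exp (- b / \<sigma>)))"
proof -
  have "(\<integral>\<^sup>+z\<in>{a..b}. ennreal (exp (- \<bar>z\<bar> / \<sigma>)) \<partial>lborel)
      = (\<integral>\<^sup>+z\<in>{a..b}. ennreal (exp (- z / \<sigma>)) \<partial>lborel)"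
    using assms by (intro nn_integral_cong) (auto simp: indicator_def)
  also have "\<dots> = ennreal (- \<sigma> * exp (- b / \<sigma>) - (- \<sigma> * exp (- a / \<sigma>)))"
    using assms by (intro nn_integral_FTC_Icc) (auto intro!: derivative_eq_intros)
  finally show ?thesis by (simp add: algebra_simps)
qed

lemma nn_integral_exp_atLeast_0:
  assumes "0 < \<sigma>"
  shows "(\<integral>\<^sup>+z\<in>{0..}. ennreal (exp (- \<bar>z\<bar> / \<sigma>)) \<partial>lborel) = ennreal \<sigma>"
proof -
  have "(\<integral>\<^sup>+z\<in>{0..}. ennreal (exp (- \<bar>z\<bar> / \<sigma>)) \<partial>lborel)
      = (\<integral>\<^sup>+z\<in>{0..}. ennreal (exp (- z / \<sigma>)) \<partial>lborel)"
    by (intro nn_integral_cong) (auto simp: indicator_def)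
  also have "\<dots> = ennreal (0 - (- \<sigma> * exp (- 0 / \<sigma>)))"
  proof (intro nn_integral_FTC_atLeast)
    have "filterlim (\<lambda>z. (1 / \<sigma>) * z) at_top at_top"
      using assms by (intro filterlim_tendsto_pos_mult_at_top[OF tendsto_const _ filterlim_ident]) auto
    then have "filterlim (\<lambda>z. - z / \<sigma>) at_bot at_top"
      by (simp add: filterlim_uminus_at_top)
    then have "((\<lambda>z. exp (- z / \<sigma>)) \<longlongrightarrow> 0) at_top"
      by (rule filterlim_compose[OF exp_at_bot])
    then show "((\<lambda>z. - \<sigma> * exp (- z / \<sigma>)) \<longlongrightarrow> 0) at_top"
      by (rule tendsto_mult_right_zero)
  qed (use assms in \<open>auto intro!: derivative_eq_intros\<close>)
  finally show ?thesis by simp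
qed

lemma nn_integral_exp_even:
  assumes [measurable]: "S \<in> sets borel" and even: "uminus ` S = S"
  shows "(\<integral>\<^sup>+z\<in>S. ennreal (exp (- \<bar>z\<bar> / \<sigma>)) \<partial>lborel)
       = 2 * (\<integral>\<^sup>+z\<in>S \<inter> {0..}. ennreal (exp (- \<bar>z\<bar> / \<sigma>)) \<partial>lborel)"
proof -
  let ?k = "\<lambda>z. ennreal (exp (- \<bar>z\<bar> / \<sigma>))"
  have "uminus ` (S \<inter> {0..}) = S \<inter> {..0}"
    by (simp add: image_Int even)
  then have *: "(\<integral>\<^sup>+z\<in>S \<inter> {..0}. ?k z \<partial>lborel) = (\<integral>\<^sup>+z\<in>S \<inter> {0..}. ?k z \<partial>lborel)"
    using nn_integral_exp_reflect[of "S \<inter> {0..}" \<sigma>] by simp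
  have "(\<integral>\<^sup>+z\<in>S. ?k z \<partial>lborel)
      = (\<integral>\<^sup>+z. ?k z * indicator (S \<inter> {0..}) z + ?k z * indicator (S \<inter> {..0}) z \<partial>lborel)"
    \<comment> \<open>The two halves overlap in the null set \<open>{0}\<close>.\<close>
    by (intro nn_integral_cong_AE AE_I'[of "{0}"]) (auto simp: indicator_def)
  also have "\<dots> = 2 * (\<integral>\<^sup>+z\<in>S \<inter> {0..}. ?k z \<partial>lborel)"
    by (subst nn_integral_add) (simp_all add: * mult_2 del: divide_minus_left)
  finally show ?thesis .
qed

lemma nn_integral_exp_UNIV:
  assumes "0 < \<sigma>"
  shows "(\<integral>\<^sup>+z. ennreal (exp (- \<bar>z\<bar> / \<sigma>)) \<partial>lborel) = ennreal (2 * \<sigma>)"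
  using nn_integral_exp_even[of UNIV \<sigma>] assms
  by (simp add: nn_integral_exp_atLeast_0 ennreal_mult del: divide_minus_left)

lemma nn_integral_exp_Icc_symmetric:
  assumes "0 < \<sigma>" "0 \<le> s"
  shows "(\<integral>\<^sup>+z\<in>{-s..s}. ennreal (exp (- \<bar>z\<bar> / \<sigma>)) \<partial>lborel) = ennreal (2 * \<sigma> * (1 - exp (- s / \<sigma>)))"
proof -
  have "{-s..s} \<inter> {0..} = {0..s}" using assms by auto
  then have "(\<integral>\<^sup>+z\<in>{-s..s}. ennreal (exp (- \<bar>z\<bar> / \<sigma>)) \<partial>lborel)
      = 2 * ennreal (\<sigma> * (1 - exp (- s / \<sigma>)))"
    using nn_integral_exp_even[of "{-s..s}" \<sigma>] nn_integral_exp_Icc[of \<sigma> 0 s] assms by simp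
  also have "\<dots> = ennreal (2 * (\<sigma> * (1 - exp (- s / \<sigma>))))"
    using assms by (simp add: ennreal_mult)
  finally show ?thesis by (simp add: mult.assoc)
qed

lemma laplace_altdef:
  assumes "0 < \<sigma>"
  shows "laplace \<sigma> = density lborel (\<lambda>z. ennreal (exp (- \<bar>z\<bar> / \<sigma>)) * indicator UNIV z / ennreal (2 * \<sigma>))"
  using assms by (simp add: laplace_def divide_ennreal)

lemma prob_space_laplace:
  assumes "0 < \<sigma>"
  shows "prob_space (laplace \<sigma>)"
proof (rule prob_spaceI)
  have "emeasure (laplace \<sigma>) (space (laplace \<sigma>))
      = (\<integral>\<^sup>+z. ennreal (exp (- \<bar>z\<bar> / \<sigma>)) \<partial>lborel) / ennreal (2 * \<sigma>)"
    unfolding laplace_altdef[OF assms]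
    by (simp add: emeasure_density nn_integral_divide del: divide_minus_left)
  also have "\<dots> = 1"
    unfolding nn_integral_exp_UNIV[OF assms] using assms by (simp add: divide_ennreal)
  finally show "emeasure (laplace \<sigma>) (space (laplace \<sigma>)) = 1" .
qed

lemma prob_space_trunc_laplace:
  assumes "0 < \<sigma>" "0 < s"
  shows "prob_space (trunc_laplace \<sigma> s)"
proof (rule prob_spaceI)
  have "0 < 2 * \<sigma> * (1 - exp (- s / \<sigma>))" using assms by simp
  then show "emeasure (trunc_laplace \<sigma> s) (space (trunc_laplace \<sigma> s)) = 1"
    unfolding trunc_laplace_def using assms
    by (simp add: emeasure_density nn_integral_divide nn_integral_exp_Icc_symmetric divide_ennreal del: zero_less_mult_iff divide_minus_left)
qed

lemma approx_max_div_le_laplace: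
  assumes "0 < \<sigma>"
  shows "approx_max_div_le (\<bar>u - v\<bar> / \<sigma>) 0
    (distr (laplace \<sigma>) borel ((+) u)) (distr (laplace \<sigma>) borel ((+) v))"
  unfolding laplace_altdef[OF assms]
  by (rule approx_max_div_le_shift_exp) (use assms in auto)

text \<open>
  The points covered by \<open>[u - s, u + s]\<close> but not by \<open>[v - s, v + s]\<close> form an interval of length
  \<open>\<bar>u - v\<bar>\<close> at one end of the support. The additive term is the mass of such an end piece,
  \<open>\<sigma> (exp (- (s - \<bar>u - v\<bar>) / \<sigma>) - exp (- s / \<sigma>))\<close>, divided by the total mass
  \<open>2 \<sigma> (1 - exp (- s / \<sigma>))\<close>.
\<close>

lemma approx_max_div_le_trunc_laplace:
  assumes \<sigma>: "0 < \<sigma>" and s: "0 < s" and w: "\<bar>u - v\<bar> \<le> s"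
  shows "approx_max_div_le (\<bar>u - v\<bar> / \<sigma>) ((exp (\<bar>u - v\<bar> / \<sigma>) - 1) / (2 * (exp (s / \<sigma>) - 1)))
    (distr (trunc_laplace \<sigma> s) borel ((+) u)) (distr (trunc_laplace \<sigma> s) borel ((+) v))"
  unfolding trunc_laplace_def
proof (rule approx_max_div_le_shift_exp)
  let ?k = "\<lambda>z. ennreal (exp (- \<bar>z\<bar> / \<sigma>))" and ?w = "\<bar>u - v\<bar>"
  have pos: "0 < 2 * \<sigma> * (1 - exp (- s / \<sigma>))" using \<sigma> s by simp
  define tail where "tail = {s - ?w..s}"
  have tail: "(\<integral>\<^sup>+z\<in>tail. ?k z \<partial>lborel) = ennreal (\<sigma> * (exp (- (s - ?w) / \<sigma>) - exp (- s / \<sigma>)))"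
    unfolding tail_def using assms by (intro nn_integral_exp_Icc) auto
  have "(\<integral>\<^sup>+z\<in>{z \<in> {-s..s}. u - v + z \<notin> {-s..s}}. ?k z \<partial>lborel) \<le> (\<integral>\<^sup>+z\<in>tail. ?k z \<partial>lborel)"
  proof (cases "v \<le> u")
    case True
    then show ?thesis
      by (intro nn_integral_mono) (auto simp: indicator_def tail_def)
  next
    case False
    then have "(\<integral>\<^sup>+z\<in>{z \<in> {-s..s}. u - v + z \<notin> {-s..s}}. ?k z \<partial>lborel) \<le> (\<integral>\<^sup>+z\<in>uminus ` tail. ?k z \<partial>lborel)"
      by (intro nn_integral_mono) (auto simp: indicator_def tail_def)
    then show ?thesis
      using nn_integral_exp_reflect[of tail \<sigma>] by (simp add: tail_def)
  qed
  then have "(\<integral>\<^sup>+z\<in>{z \<in> {-s..s}. u - v + z \<notin> {-s..s}}. ?k z \<partial>lborel) / (\<integral>\<^sup>+z\<in>{-s..s}. ?k z \<partial>lborel)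
     \<le> ennreal (\<sigma> * (exp (- (s - ?w) / \<sigma>) - exp (- s / \<sigma>))) / ennreal (2 * \<sigma> * (1 - exp (- s / \<sigma>)))"
    unfolding tail using \<sigma> s by (simp add: nn_integral_exp_Icc_symmetric divide_right_mono_ennreal del: divide_minus_left)
  also have "\<dots> = ennreal (\<sigma> * (exp (- (s - ?w) / \<sigma>) - exp (- s / \<sigma>)) / (2 * \<sigma> * (1 - exp (- s / \<sigma>))))"
  proof (rule divide_ennreal)
    have "- s / \<sigma> \<le> - (s - ?w) / \<sigma>" using \<sigma> by (intro divide_right_mono) auto
    then show "0 \<le> \<sigma> * (exp (- (s - ?w) / \<sigma>) - exp (- s / \<sigma>))"
      using \<sigma> by (intro mult_nonneg_nonneg) (simp_all only: diff_ge_0_iff_ge exp_le_cancel_iff less_imp_le)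
  qed (rule pos)
  also have "\<sigma> * (exp (- (s - ?w) / \<sigma>) - exp (- s / \<sigma>)) / (2 * \<sigma> * (1 - exp (- s / \<sigma>)))
      = (exp (?w / \<sigma>) - 1) / (2 * (exp (s / \<sigma>) - 1))"
  proof -
    have e: "exp (- (s - ?w) / \<sigma>) = exp (?w / \<sigma>) / exp (s / \<sigma>)" "exp (- s / \<sigma>) = 1 / exp (s / \<sigma>)"
      by (simp_all add: diff_divide_distrib exp_diff exp_minus inverse_eq_divide)
    have "1 < exp (s / \<sigma>)" using \<sigma> s by simp
    then show ?thesis unfolding e using \<sigma> by (simp add: divide_simps)
  qed
  finally show "(\<integral>\<^sup>+z\<in>{z \<in> {-s..s}. u - v + z \<notin> {-s..s}}. ?k z \<partial>lborel) / (\<integral>\<^sup>+z\<in>{-s..s}. ?k z \<partial>lborel)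
     \<le> ennreal ((exp (?w / \<sigma>) - 1) / (2 * (exp (s / \<sigma>) - 1)))" .
qed (use \<sigma> in auto)

section \<open>Noisy vectors\<close>

lemma noise_scale_pos: "0 < \<Delta> \<Longrightarrow> 0 < \<alpha> \<Longrightarrow> 0 < \<epsilon> \<Longrightarrow> 0 < noise_scale \<Delta> \<alpha> \<epsilon>"
  by (simp add: noise_scale_def)

text \<open>
  The radius is chosen so that \<open>exp (s / \<sigma>) - 1\<close> turns the tail mass of a single entry into a multiple
  of \<open>\<delta> / N\<close>. The bound \<open>\<delta> \<le> 1 / 2\<close> makes the radius at least \<open>\<Delta>\<close>, so that a shift by at most
  \<open>\<Delta>\<close> keeps the end piece of the support on one side of \<open>0\<close>.
\<close>

lemma trunc_radius_bounds:
  assumes "0 < \<Delta>" "0 < \<alpha>" "0 < \<epsilon>" "0 < \<delta>" "\<delta> \<le> 1 / 2" "0 < N"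
  defines "\<sigma> \<equiv> noise_scale \<Delta> \<alpha> \<epsilon>" and "s \<equiv> trunc_radius \<Delta> \<alpha> \<epsilon> \<delta> N"
  shows "0 < \<sigma>" and "\<Delta> \<le> s" and "\<Delta> / \<sigma> = \<alpha> * \<epsilon>"
    and "exp (s / \<sigma>) - 1 = 2 * real N * (exp (\<alpha> * \<epsilon>) - 1) / \<delta>"
proof -
  show \<sigma>: "0 < \<sigma>" and D: "\<Delta> / \<sigma> = \<alpha> * \<epsilon>" using assms by (simp_all add: noise_scale_def)
  define r where "r = 2 * real N * (exp (\<alpha> * \<epsilon>) - 1) / \<delta>"
  \<comment> \<open>As \<open>2 N / \<delta> \<ge> 1\<close>, the logarithm in the radius is at least \<open>\<alpha> \<epsilon> = \<Delta> / \<sigma>\<close>.\<close>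
  have "1 * (exp (\<alpha> * \<epsilon>) - 1) \<le> (2 * real N / \<delta>) * (exp (\<alpha> * \<epsilon>) - 1)"
    using assms by (intro mult_right_mono) (auto simp: field_simps)
  then have r: "exp (\<alpha> * \<epsilon>) \<le> r + 1" by (simp add: r_def)
  then have "0 < r + 1" using exp_gt_zero[of "\<alpha> * \<epsilon>"] by linarith
  have s: "s / \<sigma> = ln (r + 1)"
    using assms(1-3) by (simp add: s_def \<sigma>_def trunc_radius_def noise_scale_def r_def)
  then show "exp (s / \<sigma>) - 1 = 2 * real N * (exp (\<alpha> * \<epsilon>) - 1) / \<delta>"
    using \<open>0 < r + 1\<close> by (simp add: r_def)
  have "\<Delta> / \<sigma> \<le> s / \<sigma>"
    unfolding s D using r \<open>0 < r + 1\<close> by (simp add: ln_ge_iff)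
  then show "\<Delta> \<le> s" using \<sigma> by (simp add: divide_le_cancel)
qed

text \<open>
  The law of a vector \<open>u\<close> with independent noise added to its entries. The constant offsets \<open>s\<^sub>A\<close> and
  \<open>- s\<^sub>b\<close> of the algorithm are not included: they do not depend on the database and are left to the
  post-processing.
\<close>

definition trunc_noised :: "real \<Rightarrow> real \<Rightarrow> real \<Rightarrow> real \<Rightarrow> 'i set \<Rightarrow> ('i \<Rightarrow> real) \<Rightarrow> ('i \<Rightarrow> real) measure" where
  "trunc_noised \<Delta> \<alpha> \<epsilon> \<delta> I u =
     (\<Pi>\<^sub>M i\<in>I. distr (trunc_laplace (noise_scale \<Delta> \<alpha> \<epsilon>) (trunc_radius \<Delta> \<alpha> \<epsilon> \<delta> (card I))) borel ((+) (u i)))"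

definition laplace_noised :: "real \<Rightarrow> real \<Rightarrow> real \<Rightarrow> 'i set \<Rightarrow> ('i \<Rightarrow> real) \<Rightarrow> ('i \<Rightarrow> real) measure" where
  "laplace_noised \<Delta> \<alpha> \<epsilon> I u = (\<Pi>\<^sub>M i\<in>I. distr (laplace (noise_scale \<Delta> \<alpha> \<epsilon>)) borel ((+) (u i)))"

lemma measurable_plus_laplace [measurable]:
  "(+) a \<in> trunc_laplace \<sigma> s \<rightarrow>\<^sub>M borel" "(+) a \<in> laplace \<sigma> \<rightarrow>\<^sub>M borel"
  by (simp_all add: trunc_laplace_def laplace_def)

lemma measurable_PiM_shift:
  assumes "\<And>a. (+) a \<in> N \<rightarrow>\<^sub>M borel"
  shows "(\<lambda>z. \<lambda>i\<in>I. u i + z i) \<in> (\<Pi>\<^sub>M i\<in>I. N) \<rightarrow>\<^sub>M (\<Pi>\<^sub>M i\<in>I. borel)"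
proof (rule measurable_restrict)
  show "(\<lambda>z. u i + z i) \<in> (\<Pi>\<^sub>M i\<in>I. N) \<rightarrow>\<^sub>M borel" if "i \<in> I" for i
    by (rule measurable_compose[OF measurable_component_singleton[OF that] assms])
qed

context
  fixes \<Delta> \<alpha> \<epsilon> \<delta> :: real and I :: "'i set"
  assumes params: "0 < \<Delta>" "0 < \<alpha>" "0 < \<epsilon>" "0 < \<delta>" "\<delta> \<le> 1 / 2" and I: "finite I" "I \<noteq> {}"
begin

lemma prob_space_trunc_laplace_radius:
  "prob_space (trunc_laplace (noise_scale \<Delta> \<alpha> \<epsilon>) (trunc_radius \<Delta> \<alpha> \<epsilon> \<delta> (card I)))"
  using trunc_radius_bounds(1,2)[OF params, of "card I"] I params
  by (intro prob_space_trunc_laplace) (auto simp: card_gt_0_iff)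

lemma prob_space_trunc_noised: "prob_space (trunc_noised \<Delta> \<alpha> \<epsilon> \<delta> I u)"
  unfolding trunc_noised_def
  by (intro prob_space_PiM prob_space.prob_space_distr prob_space_trunc_laplace_radius measurable_plus_laplace)

lemma trunc_noised_eq_distr:
  "trunc_noised \<Delta> \<alpha> \<epsilon> \<delta> I u =
     distr (\<Pi>\<^sub>M i\<in>I. trunc_laplace (noise_scale \<Delta> \<alpha> \<epsilon>) (trunc_radius \<Delta> \<alpha> \<epsilon> \<delta> (card I)))
       (\<Pi>\<^sub>M i\<in>I. borel) (\<lambda>z. \<lambda>i\<in>I. u i + z i)"
  unfolding trunc_noised_def
  by (rule distr_PiM_coordinatewise[symmetric]) (auto intro: prob_space_trunc_laplace_radius measurable_plus_laplace)

text \<open>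
  Each entry consumes its share \<open>\<bar>u i - v i\<bar> / \<sigma>\<close> of the privacy budget, and the shares add up to at most
  \<open>\<Delta> / \<sigma> = \<alpha> \<epsilon>\<close>. For the additive term every entry is charged
  the worst case \<open>\<bar>u i - v i\<bar> = \<Delta>\<close>, and this is why the number of entries appears in the radius.
\<close>

lemma approx_max_div_le_trunc_noised:
  assumes uv: "(\<Sum>i\<in>I. \<bar>u i - v i\<bar>) \<le> \<Delta>"
  shows "approx_max_div_le (\<alpha> * \<epsilon>) (\<delta> / 2) (trunc_noised \<Delta> \<alpha> \<epsilon> \<delta> I u) (trunc_noised \<Delta> \<alpha> \<epsilon> \<delta> I v)"
proof -
  define \<sigma> s where "\<sigma> = noise_scale \<Delta> \<alpha> \<epsilon>" and "s = trunc_radius \<Delta> \<alpha> \<epsilon> \<delta> (card I)"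
  have N: "0 < card I" using I by (simp add: card_gt_0_iff)
  note b = trunc_radius_bounds[OF params N, folded \<sigma>_def s_def]
  have s: "0 < s" using b(2) params by linarith
  have p: "prob_space (distr (trunc_laplace \<sigma> s) borel ((+) a))" for a :: real
    by (intro prob_space.prob_space_distr prob_space_trunc_laplace b s measurable_plus_laplace)
  have step: "approx_max_div_le (\<bar>u i - v i\<bar> / \<sigma>) (\<delta> / (4 * real (card I)))
     (distr (trunc_laplace \<sigma> s) borel ((+) (u i))) (distr (trunc_laplace \<sigma> s) borel ((+) (v i)))"
    if i: "i \<in> I" for i
  proof -
    have w: "\<bar>u i - v i\<bar> \<le> \<Delta>"
      using member_le_sum[of i I "\<lambda>i. \<bar>u i - v i\<bar>"] i I uv by auto
    have "exp (\<bar>u i - v i\<bar> / \<sigma>) \<le> exp (\<alpha> * \<epsilon>)"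
      unfolding b(3)[symmetric] using w b(1) by (simp add: divide_right_mono)
    moreover have "1 < exp (\<alpha> * \<epsilon>)" using params by simp
    ultimately have "(exp (\<bar>u i - v i\<bar> / \<sigma>) - 1) / (2 * (exp (s / \<sigma>) - 1)) \<le> \<delta> / (4 * real (card I))"
      unfolding b(4) using params N by (simp add: field_simps)
    moreover have "\<bar>u i - v i\<bar> \<le> s" using w b(2) by simp
    ultimately show ?thesis
      using approx_max_div_le_mono[OF approx_max_div_le_trunc_laplace[OF b(1) s]] by blast
  qed
  have "approx_max_div_le (\<Sum>i\<in>I. \<bar>u i - v i\<bar> / \<sigma>) (\<Sum>i\<in>I. \<delta> / (4 * real (card I)))
    (trunc_noised \<Delta> \<alpha> \<epsilon> \<delta> I u) (trunc_noised \<Delta> \<alpha> \<epsilon> \<delta> I v)"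
    unfolding trunc_noised_def \<sigma>_def[symmetric] s_def[symmetric]
    by (intro approx_max_div_le_PiM I step p) (use params in auto)
  moreover have "(\<Sum>i\<in>I. \<bar>u i - v i\<bar> / \<sigma>) \<le> \<alpha> * \<epsilon>"
    unfolding b(3)[symmetric] sum_divide_distrib[symmetric] using uv b(1) by (simp add: divide_right_mono)
  moreover have "(\<Sum>i\<in>I. \<delta> / (4 * real (card I))) \<le> \<delta> / 2"
    using N params by simp
  ultimately show ?thesis by (rule approx_max_div_le_mono)
qed

end

context
  fixes \<Delta> \<alpha> \<epsilon> :: real and I :: "'i set"
  assumes params: "0 < \<Delta>" "0 < \<alpha>" "0 < \<epsilon>" and I: "finite I"
begin

lemma prob_space_laplace_noised: "prob_space (laplace_noised \<Delta> \<alpha> \<epsilon> I u)"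
  unfolding laplace_noised_def
  by (intro prob_space_PiM prob_space.prob_space_distr prob_space_laplace noise_scale_pos params measurable_plus_laplace)

lemma laplace_noised_eq_distr:
  "laplace_noised \<Delta> \<alpha> \<epsilon> I u =
     distr (\<Pi>\<^sub>M i\<in>I. laplace (noise_scale \<Delta> \<alpha> \<epsilon>)) (\<Pi>\<^sub>M i\<in>I. borel) (\<lambda>z. \<lambda>i\<in>I. u i + z i)"
  unfolding laplace_noised_def
  by (rule distr_PiM_coordinatewise[symmetric]) (auto intro: prob_space_laplace noise_scale_pos params measurable_plus_laplace)

text \<open>
  The classical Laplace mechanism: without truncation there is no bad set and no additive term.
\<close>

lemma approx_max_div_le_laplace_noised:
  assumes uv: "(\<Sum>i\<in>I. \<bar>u i - v i\<bar>) \<le> \<Delta>"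
  shows "approx_max_div_le (\<alpha> * \<epsilon>) 0 (laplace_noised \<Delta> \<alpha> \<epsilon> I u) (laplace_noised \<Delta> \<alpha> \<epsilon> I v)"
proof -
  define \<sigma> where "\<sigma> = noise_scale \<Delta> \<alpha> \<epsilon>"
  have \<sigma>: "0 < \<sigma>" and D: "\<Delta> / \<sigma> = \<alpha> * \<epsilon>" using params by (simp_all add: \<sigma>_def noise_scale_def)
  have p: "prob_space (distr (laplace \<sigma>) borel ((+) a))" for a :: real
    by (intro prob_space.prob_space_distr prob_space_laplace \<sigma> measurable_plus_laplace)
  have "approx_max_div_le (\<Sum>i\<in>I. \<bar>u i - v i\<bar> / \<sigma>) (\<Sum>i\<in>I. 0)
    (laplace_noised \<Delta> \<alpha> \<epsilon> I u) (laplace_noised \<Delta> \<alpha> \<epsilon> I v)"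
    unfolding laplace_noised_def \<sigma>_def[symmetric]
    by (intro approx_max_div_le_PiM I approx_max_div_le_laplace \<sigma> p) auto
  moreover have "(\<Sum>i\<in>I. \<bar>u i - v i\<bar> / \<sigma>) \<le> \<alpha> * \<epsilon>"
    unfolding D[symmetric] sum_divide_distrib[symmetric] using uv \<sigma> by (simp add: divide_right_mono)
  ultimately show ?thesis by (rule approx_max_div_le_mono) simp
qed

end

section \<open>The algorithm as post-processing of noisy data\<close>

lemma borel_measurable_vec_lambda:
  fixes f :: "'a \<Rightarrow> 'n::finite \<Rightarrow> 'b::euclidean_space"
  assumes "\<And>i. (\<lambda>x. f x i) \<in> borel_measurable M"
  shows "(\<lambda>x. \<chi> i. f x i) \<in> borel_measurable M"
proof (rule borel_measurable_euclidean_space[THEN iffD2], rule ballI)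
  fix k :: "'b ^ 'n" assume "k \<in> Basis"
  then obtain i u where "k = axis i u" by (auto simp: Basis_vec_def)
  moreover have "(\<lambda>x. f x i \<bullet> u) \<in> borel_measurable M"
    by (intro borel_measurable_inner assms borel_measurable_const)
  ultimately show "(\<lambda>x. (\<chi> i. f x i) \<bullet> k) \<in> borel_measurable M"
    by (simp add: inner_axis)
qed

lemma sensitivity_bound:
  assumes "bdd_above (sensitivity_values nrm \<D> f)" "D \<in> \<D>" "D' \<in> \<D>" "adjacent D D'"
  shows "nrm (f D - f D') \<le> sensitivity nrm \<D> f"
  unfolding sensitivity_def using assms by (intro cSup_upper) (auto simp: sensitivity_values_def)

text \<open>
  Everything that the algorithm does to the noisy data before solving. It depends on the database only
  through constants common to the whole of \<open>\<D>\<close>, hence is post-processing. Entries that are not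
  sensitive are replaced by \<open>0\<close>, which is their value on every database of \<open>\<D>\<close>.
\<close>

definition clip_data ::
    "('e ^ 'k) set \<Rightarrow> ('e ^ 'k \<Rightarrow> real ^ 'n ^ 'm) \<Rightarrow> ('e ^ 'k \<Rightarrow> real ^ 'm) \<Rightarrow> ('e ^ 'k \<Rightarrow> real ^ 'n)
     \<Rightarrow> real \<Rightarrow> real \<Rightarrow> ('m \<times> 'n \<Rightarrow> real) \<times> ('m \<Rightarrow> real) \<times> ('n \<Rightarrow> real)
     \<Rightarrow> (real ^ 'n ^ 'm) \<times> (real ^ 'm) \<times> (real ^ 'n)" where
  "clip_data \<D> A b c s\<^sub>A s\<^sub>b = (\<lambda>(Y, y, w).
     (\<chi> i j. min ((Y (i, j) + s\<^sub>A) * of_bool (sensitive_mat \<D> A i j)) (SUP D\<in>\<D>. A D $ i $ j),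
      \<chi> i. max (y i - s\<^sub>b) (INF D\<in>\<D>. b D $ i),
      \<chi> j. if sensitive_vec \<D> c j then w j else 0))"

lemma clip_data_shift:
  assumes "D \<in> \<D>"
  shows "clip_data \<D> A b c s\<^sub>A s\<^sub>b
      (\<lambda>ij\<in>UNIV. A D $ fst ij $ snd ij + Z ij, \<lambda>i\<in>UNIV. b D $ i + z\<^sub>b i,
       \<lambda>j\<in>{j. sensitive_vec \<D> c j}. c D $ j + z\<^sub>c j)
    = (private_A \<D> A s\<^sub>A D Z, private_b \<D> b s\<^sub>b D z\<^sub>b, private_c \<D> c D z\<^sub>c)"
  using assms
  by (auto simp: clip_data_def private_A_def private_b_def private_c_def vec_eq_iff
      sensitive_mat_def sensitive_vec_def algebra_simps)

lemma measurable_clip_data: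
  "clip_data \<D> A b c s\<^sub>A s\<^sub>b \<in> PiM UNIV (\<lambda>_. borel) \<Otimes>\<^sub>M PiM UNIV (\<lambda>_. borel) \<Otimes>\<^sub>M
     PiM {j. sensitive_vec \<D> c j} (\<lambda>_. borel) \<rightarrow>\<^sub>M borel"
proof -
  have [measurable]: "(\<lambda>w. if sensitive_vec \<D> c j then w j else 0) \<in>
      PiM {j. sensitive_vec \<D> c j} (\<lambda>_. borel) \<rightarrow>\<^sub>M (borel :: real measure)" for j
    by (cases "sensitive_vec \<D> c j") (auto intro: measurable_component_singleton)
  show ?thesis
    unfolding clip_data_def borel_prod[symmetric] case_prod_beta
    by (intro measurable_Pair borel_measurable_vec_lambda) measurable
qed

lemma distr_pair3:
  assumes f: "f \<in> M1 \<rightarrow>\<^sub>M K1" "g \<in> M2 \<rightarrow>\<^sub>M K2" "h \<in> M3 \<rightarrow>\<^sub>M K3"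
    and p: "prob_space M2" "prob_space M3"
  shows "distr M1 K1 f \<Otimes>\<^sub>M distr M2 K2 g \<Otimes>\<^sub>M distr M3 K3 h
    = distr (M1 \<Otimes>\<^sub>M M2 \<Otimes>\<^sub>M M3) (K1 \<Otimes>\<^sub>M K2 \<Otimes>\<^sub>M K3) (\<lambda>(x, y, z). (f x, g y, h z))"
proof -
  have sigma_finite: "sigma_finite_measure (distr M2 K2 g)" "sigma_finite_measure (distr M3 K3 h)"
    by (intro prob_space_imp_sigma_finite prob_space.prob_space_distr p f)+
  have gh: "(\<lambda>(y, z). (g y, h z)) \<in> M2 \<Otimes>\<^sub>M M3 \<rightarrow>\<^sub>M K2 \<Otimes>\<^sub>M K3"
    using f(2,3) by measurable
  have 1: "distr M2 K2 g \<Otimes>\<^sub>M distr M3 K3 h = distr (M2 \<Otimes>\<^sub>M M3) (K2 \<Otimes>\<^sub>M K3) (\<lambda>(y, z). (g y, h z))"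
    by (rule pair_measure_distr[OF f(2,3) sigma_finite(2)])
  have 2: "sigma_finite_measure (distr (M2 \<Otimes>\<^sub>M M3) (K2 \<Otimes>\<^sub>M K3) (\<lambda>(y, z). (g y, h z)))"
    by (intro prob_space_imp_sigma_finite prob_space.prob_space_distr prob_space_pair p gh)
  show ?thesis
    unfolding 1 by (subst pair_measure_distr[OF f(1) gh 2]) (simp add: case_prod_beta')
qed

text \<open>
  This separates the private part of the algorithm, in which the database is seen only through noise,
  from post-processing that does not see the database.
\<close>

lemma algorithm1_eq_distr:
  fixes \<D> :: "('e ^ 'k) set"
    and A :: "'e ^ 'k \<Rightarrow> real ^ 'n ^ 'm" and b :: "'e ^ 'k \<Rightarrow> real ^ 'm" and c :: "'e ^ 'k \<Rightarrow> real ^ 'n"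
  defines "\<Delta>\<^sub>A \<equiv> sensitivity l11_norm \<D> A" and "\<Delta>\<^sub>b \<equiv> sensitivity l1_norm \<D> b"
    and "\<Delta>\<^sub>c \<equiv> sensitivity l1_norm \<D> c"
  assumes D: "D \<in> \<D>" and solver: "solve \<in> borel \<rightarrow>\<^sub>M borel"
    and \<epsilon>: "0 < \<epsilon>" and \<delta>: "0 < \<delta>" "\<delta> \<le> 1 / 2"
    and \<alpha>: "0 < \<alpha>\<^sub>A" "0 < \<alpha>\<^sub>b" "0 < \<alpha>\<^sub>c" and \<Delta>: "0 < \<Delta>\<^sub>A" "0 < \<Delta>\<^sub>b" "0 < \<Delta>\<^sub>c"
  shows "algorithm1 \<D> A b c \<epsilon> \<delta> \<alpha>\<^sub>A \<alpha>\<^sub>b \<alpha>\<^sub>c solve D =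
    distr (trunc_noised \<Delta>\<^sub>A \<alpha>\<^sub>A \<epsilon> \<delta> UNIV (\<lambda>ij. A D $ fst ij $ snd ij)
           \<Otimes>\<^sub>M trunc_noised \<Delta>\<^sub>b \<alpha>\<^sub>b \<epsilon> \<delta> UNIV (\<lambda>i. b D $ i)
           \<Otimes>\<^sub>M laplace_noised \<Delta>\<^sub>c \<alpha>\<^sub>c \<epsilon> {j. sensitive_vec \<D> c j} (\<lambda>j. c D $ j)) borel
      (solve \<circ> clip_data \<D> A b c
        (trunc_radius \<Delta>\<^sub>A \<alpha>\<^sub>A \<epsilon> \<delta> (CARD('n) * CARD('m))) (trunc_radius \<Delta>\<^sub>b \<alpha>\<^sub>b \<epsilon> \<delta> CARD('m)))"
proof -
  let ?J = "{j. sensitive_vec \<D> c j}"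
  let ?s\<^sub>A = "trunc_radius \<Delta>\<^sub>A \<alpha>\<^sub>A \<epsilon> \<delta> (CARD('n) * CARD('m))" and ?s\<^sub>b = "trunc_radius \<Delta>\<^sub>b \<alpha>\<^sub>b \<epsilon> \<delta> CARD('m)"
  let ?MA = "\<Pi>\<^sub>M ij\<in>(UNIV :: ('m \<times> 'n) set). trunc_laplace (noise_scale \<Delta>\<^sub>A \<alpha>\<^sub>A \<epsilon>) ?s\<^sub>A"
    and ?Mb = "\<Pi>\<^sub>M i\<in>(UNIV :: 'm set). trunc_laplace (noise_scale \<Delta>\<^sub>b \<alpha>\<^sub>b \<epsilon>) ?s\<^sub>b"
    and ?Mc = "\<Pi>\<^sub>M j\<in>?J. laplace (noise_scale \<Delta>\<^sub>c \<alpha>\<^sub>c \<epsilon>)"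
  let ?BA = "\<Pi>\<^sub>M ij\<in>(UNIV :: ('m \<times> 'n) set). (borel :: real measure)"
    and ?Bb = "\<Pi>\<^sub>M i\<in>(UNIV :: 'm set). (borel :: real measure)" and ?Bc = "\<Pi>\<^sub>M j\<in>?J. (borel :: real measure)"
  let ?fA = "\<lambda>Z. \<lambda>ij\<in>UNIV. A D $ fst ij $ snd ij + Z ij" and ?fb = "\<lambda>z. \<lambda>i\<in>UNIV. b D $ i + z i"
    and ?fc = "\<lambda>z. \<lambda>j\<in>?J. c D $ j + z j"
  let ?clip = "clip_data \<D> A b c ?s\<^sub>A ?s\<^sub>b" and ?shift = "\<lambda>(Z, z\<^sub>b, z\<^sub>c). (?fA Z, ?fb z\<^sub>b, ?fc z\<^sub>c)"
  have card: "card (UNIV :: ('m \<times> 'n) set) = CARD('n) * CARD('m)" by (simp add: card_prod)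
  have f: "?fA \<in> ?MA \<rightarrow>\<^sub>M ?BA" "?fb \<in> ?Mb \<rightarrow>\<^sub>M ?Bb" "?fc \<in> ?Mc \<rightarrow>\<^sub>M ?Bc"
    by (intro measurable_PiM_shift measurable_plus_laplace)+
  have p: "prob_space ?Mb" "prob_space ?Mc"
    using prob_space_trunc_laplace_radius[OF \<Delta>(2) \<alpha>(2) \<epsilon> \<delta>, where I = "UNIV :: 'm set"]
      prob_space_laplace[OF noise_scale_pos[OF \<Delta>(3) \<alpha>(3) \<epsilon>]]
    by (auto intro: prob_space_PiM)
  have "trunc_noised \<Delta>\<^sub>A \<alpha>\<^sub>A \<epsilon> \<delta> UNIV (\<lambda>ij. A D $ fst ij $ snd ij) = distr ?MA ?BA ?fA"
    using trunc_noised_eq_distr[OF \<Delta>(1) \<alpha>(1) \<epsilon> \<delta>, where I = "UNIV :: ('m \<times> 'n) set"]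
    by (simp only: card) simp
  moreover have "trunc_noised \<Delta>\<^sub>b \<alpha>\<^sub>b \<epsilon> \<delta> UNIV (\<lambda>i. b D $ i) = distr ?Mb ?Bb ?fb"
    by (intro trunc_noised_eq_distr \<Delta> \<alpha> \<epsilon> \<delta>) auto
  moreover have "laplace_noised \<Delta>\<^sub>c \<alpha>\<^sub>c \<epsilon> ?J (\<lambda>j. c D $ j) = distr ?Mc ?Bc ?fc"
    by (intro laplace_noised_eq_distr \<Delta> \<alpha> \<epsilon>) auto
  ultimately have "distr (trunc_noised \<Delta>\<^sub>A \<alpha>\<^sub>A \<epsilon> \<delta> UNIV (\<lambda>ij. A D $ fst ij $ snd ij)
           \<Otimes>\<^sub>M trunc_noised \<Delta>\<^sub>b \<alpha>\<^sub>b \<epsilon> \<delta> UNIV (\<lambda>i. b D $ i)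
           \<Otimes>\<^sub>M laplace_noised \<Delta>\<^sub>c \<alpha>\<^sub>c \<epsilon> ?J (\<lambda>j. c D $ j)) borel (solve \<circ> ?clip)
    = distr (distr (?MA \<Otimes>\<^sub>M ?Mb \<Otimes>\<^sub>M ?Mc) (?BA \<Otimes>\<^sub>M ?Bb \<Otimes>\<^sub>M ?Bc) ?shift) borel (solve \<circ> ?clip)"
    by (simp only: distr_pair3[OF f p])
  also have "\<dots> = distr (?MA \<Otimes>\<^sub>M ?Mb \<Otimes>\<^sub>M ?Mc) borel (solve \<circ> ?clip \<circ> ?shift)"
    using f by (intro distr_distr measurable_comp[OF measurable_clip_data solver]) measurable
  also have "solve \<circ> ?clip \<circ> ?shift = (\<lambda>(Z, z\<^sub>b, z\<^sub>c).
      solve (private_A \<D> A ?s\<^sub>A D Z, private_b \<D> b ?s\<^sub>b D z\<^sub>b, private_c \<D> c D z\<^sub>c))"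
    by (simp add: fun_eq_iff clip_data_shift[OF D] del: restrict_UNIV)
  finally show ?thesis
    by (simp only: algorithm1_def Let_def \<Delta>\<^sub>A_def \<Delta>\<^sub>b_def \<Delta>\<^sub>c_def)
qed

theorem theorem3p9:
  fixes \<D> :: "('e :: metric_space ^ 'k) set"
    and A :: "'e ^ 'k \<Rightarrow> real ^ 'n ^ 'm"
    and b :: "'e ^ 'k \<Rightarrow> real ^ 'm"
    and c :: "'e ^ 'k \<Rightarrow> real ^ 'n"
    and \<epsilon> \<delta> \<alpha>\<^sub>A \<alpha>\<^sub>b \<alpha>\<^sub>c :: real
    and solve :: "(real ^ 'n ^ 'm) \<times> (real ^ 'm) \<times> (real ^ 'n) \<Rightarrow> real ^ 'n"
  assumes "\<epsilon> > 0" and "0 < \<delta>" and "\<delta> \<le> 1 / 2"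
    and "\<alpha>\<^sub>A > 0" and "\<alpha>\<^sub>b > 0" and "\<alpha>\<^sub>c > 0" and "\<alpha>\<^sub>A + \<alpha>\<^sub>b + \<alpha>\<^sub>c = 1"
    and sens_A: "bdd_above (sensitivity_values l11_norm \<D> A)" "sensitivity l11_norm \<D> A > 0"
    and sens_b: "bdd_above (sensitivity_values l1_norm \<D> b)" "sensitivity l1_norm \<D> b > 0"
    and sens_c: "bdd_above (sensitivity_values l1_norm \<D> c)" "sensitivity l1_norm \<D> c > 0"
    and slater: "\<forall>D\<in>\<D>. \<exists>x. \<forall>i. (A D *v x) $ i < b D $ i"
    and boundedness: "bounded \<D>"
      "\<forall>i j. bdd_above ((\<lambda>D. A D $ i $ j) ` \<D>)" "\<forall>i. bdd_below ((\<lambda>D. b D $ i) ` \<D>)"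
    and perturbed_feasibility: "(\<Inter>D\<in>\<D>. {x. \<forall>i. (A D *v x) $ i \<le> b D $ i}) \<noteq> {}"
    and solver: "solve \<in> borel \<rightarrow>\<^sub>M borel"
  shows "differentially_private \<epsilon> \<delta> \<D> (algorithm1 \<D> A b c \<epsilon> \<delta> \<alpha>\<^sub>A \<alpha>\<^sub>b \<alpha>\<^sub>c solve)"
proof -
  define \<Delta>\<^sub>A \<Delta>\<^sub>b \<Delta>\<^sub>c where "\<Delta>\<^sub>A = sensitivity l11_norm \<D> A" and "\<Delta>\<^sub>b = sensitivity l1_norm \<D> b"
    and "\<Delta>\<^sub>c = sensitivity l1_norm \<D> c"
  note \<Delta>_defs = \<Delta>\<^sub>A_def \<Delta>\<^sub>b_def \<Delta>\<^sub>c_def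
  have \<Delta>: "0 < \<Delta>\<^sub>A" "0 < \<Delta>\<^sub>b" "0 < \<Delta>\<^sub>c" using sens_A sens_b sens_c by (simp_all add: \<Delta>_defs)
  define J where "J = {j. sensitive_vec \<D> c j}"
  define PA where "PA D = trunc_noised \<Delta>\<^sub>A \<alpha>\<^sub>A \<epsilon> \<delta> UNIV (\<lambda>ij. A D $ fst ij $ snd ij)" for D
  define Pb where "Pb D = trunc_noised \<Delta>\<^sub>b \<alpha>\<^sub>b \<epsilon> \<delta> UNIV (\<lambda>i. b D $ i)" for D
  define Pc where "Pc D = laplace_noised \<Delta>\<^sub>c \<alpha>\<^sub>c \<epsilon> J (\<lambda>j. c D $ j)" for D
  define post where "post = solve \<circ> clip_data \<D> A b c
    (trunc_radius \<Delta>\<^sub>A \<alpha>\<^sub>A \<epsilon> \<delta> (CARD('n) * CARD('m))) (trunc_radius \<Delta>\<^sub>b \<alpha>\<^sub>b \<epsilon> \<delta> CARD('m))"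
  define M where "M = algorithm1 \<D> A b c \<epsilon> \<delta> \<alpha>\<^sub>A \<alpha>\<^sub>b \<alpha>\<^sub>c solve"
  have M: "M D = distr (PA D \<Otimes>\<^sub>M Pb D \<Otimes>\<^sub>M Pc D) borel post" if "D \<in> \<D>" for D
    unfolding M_def PA_def Pb_def Pc_def post_def J_def \<Delta>_defs
    by (rule algorithm1_eq_distr) (use that solver assms(1-6) \<Delta> in \<open>simp_all add: \<Delta>_defs\<close>)
  have sets: "sets (PA D \<Otimes>\<^sub>M Pb D \<Otimes>\<^sub>M Pc D) =
      sets (PiM UNIV (\<lambda>_. borel) \<Otimes>\<^sub>M PiM UNIV (\<lambda>_. borel) \<Otimes>\<^sub>M PiM J (\<lambda>_. borel))" for D
    unfolding PA_def Pb_def Pc_def trunc_noised_def laplace_noised_def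
    by (intro sets_pair_measure_cong sets_PiM_cong) simp_all
  have post: "post \<in> PA D \<Otimes>\<^sub>M Pb D \<Otimes>\<^sub>M Pc D \<rightarrow>\<^sub>M borel" for D
    unfolding measurable_cong_sets[OF sets refl] unfolding post_def J_def
    by (rule measurable_comp[OF measurable_clip_data solver])
  have p: "prob_space (PA D)" "prob_space (Pb D)" "prob_space (Pc D)" for D
    unfolding PA_def Pb_def Pc_def
    by (intro prob_space_trunc_noised prob_space_laplace_noised \<Delta> assms(1-6); simp)+
  have prob_M: "prob_space (M D)" if "D \<in> \<D>" for D
    unfolding M[OF that] by (intro prob_space.prob_space_distr prob_space_pair p post)
  have dp: "approx_max_div_le \<epsilon> \<delta> (M D) (M D')"
    if D: "D \<in> \<D>" and D': "D' \<in> \<D>" and adj: "adjacent D D'" for D D'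
  proof -
    have "(\<Sum>ij\<in>UNIV. \<bar>A D $ fst ij $ snd ij - A D' $ fst ij $ snd ij\<bar>) = l11_norm (A D - A D')"
      by (simp add: l11_norm_def sum.cartesian_product case_prod_beta)
    also have "\<dots> \<le> \<Delta>\<^sub>A" unfolding \<Delta>_defs by (rule sensitivity_bound[OF sens_A(1) that])
    finally have "approx_max_div_le (\<alpha>\<^sub>A * \<epsilon>) (\<delta> / 2) (PA D) (PA D')"
      unfolding PA_def by (intro approx_max_div_le_trunc_noised \<Delta> assms(1-6)) auto
    moreover have "(\<Sum>i\<in>UNIV. \<bar>b D $ i - b D' $ i\<bar>) \<le> \<Delta>\<^sub>b"
      using sensitivity_bound[OF sens_b(1) that] by (simp add: \<Delta>_defs l1_norm_def)
    then have "approx_max_div_le (\<alpha>\<^sub>b * \<epsilon>) (\<delta> / 2) (Pb D) (Pb D')"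
      unfolding Pb_def by (intro approx_max_div_le_trunc_noised \<Delta> assms(1-6)) auto
    moreover have "(\<Sum>j\<in>J. \<bar>c D $ j - c D' $ j\<bar>) \<le> \<Delta>\<^sub>c"
    proof -
      have "(\<Sum>j\<in>J. \<bar>c D $ j - c D' $ j\<bar>) \<le> l1_norm (c D - c D')"
        unfolding l1_norm_def by (subst vector_minus_component) (intro sum_mono2, auto)
      also have "\<dots> \<le> \<Delta>\<^sub>c" unfolding \<Delta>_defs by (rule sensitivity_bound[OF sens_c(1) that])
      finally show ?thesis .
    qed
    then have "approx_max_div_le (\<alpha>\<^sub>c * \<epsilon>) 0 (Pc D) (Pc D')"
      unfolding Pc_def by (intro approx_max_div_le_laplace_noised \<Delta> assms(1-6)) auto
    ultimately have "approx_max_div_le (\<alpha>\<^sub>A * \<epsilon> + (\<alpha>\<^sub>b * \<epsilon> + \<alpha>\<^sub>c * \<epsilon>)) (\<delta> / 2 + (\<delta> / 2 + 0))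
        (PA D \<Otimes>\<^sub>M Pb D \<Otimes>\<^sub>M Pc D) (PA D' \<Otimes>\<^sub>M Pb D' \<Otimes>\<^sub>M Pc D')"
      using assms(2) by (intro approx_max_div_le_pair prob_space_pair p) auto
    moreover have "\<alpha>\<^sub>A * \<epsilon> + (\<alpha>\<^sub>b * \<epsilon> + \<alpha>\<^sub>c * \<epsilon>) = \<epsilon>"
      using assms(7) by (simp flip: distrib_right add: add.assoc)
    ultimately have "approx_max_div_le \<epsilon> \<delta> (PA D \<Otimes>\<^sub>M Pb D \<Otimes>\<^sub>M Pc D) (PA D' \<Otimes>\<^sub>M Pb D' \<Otimes>\<^sub>M Pc D')"
      by simp
    then show ?thesis unfolding M[OF D] M[OF D'] by (rule approx_max_div_le_distr[OF _ post])
  qed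
  have "differentially_private \<epsilon> \<delta> \<D> M"
    unfolding differentially_private_def
  proof (intro conjI ballI impI)
    fix D D' and T :: "(real ^ 'n) set" assume D: "D \<in> \<D>" and D': "D' \<in> \<D>" and adj: "adjacent D D'" and T: "T \<in> sets borel"
    interpret D: prob_space "M D" by (rule prob_M[OF D])
    interpret D': prob_space "M D'" by (rule prob_M[OF D'])
    have "T \<in> sets (M D)" using T by (simp add: M[OF D])
    from approx_max_div_leD(2)[OF dp[OF D D' adj] this]
    have "ennreal (measure (M D) T) \<le> ennreal (exp \<epsilon> * measure (M D') T + \<delta>)"
      using assms(2) by (simp add: D.emeasure_eq_measure D'.emeasure_eq_measure ennreal_mult ennreal_plus)
    then show "measure (M D) T \<le> exp \<epsilon> * measure (M D') T + \<delta>"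
      using assms(2) by (subst (asm) ennreal_le_iff) auto
  next
    fix D assume "D \<in> \<D>"
    then show "prob_space (M D)" "sets (M D) = sets borel" by (rule prob_M, simp add: M)
  qed
  then show ?thesis by (simp add: M_def)
qed

end
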